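(* Let $h$ and $k$ be positive integers with $3 \leq h \leq k-1$, and let $A$ be a set of $k$ integers such that $A \cap (-A) = \emptyset$. If \[|h^{\wedge}_{\pm}A| = 2hk - h^2 + 1,\] then $A_{abs} = d \ast \{1, 3, \ldots, 2k-1\}$, where $d$ is the smallest element of $A_{abs}$.
   Context: For a finite set $A = \{a_1, \ldots, a_k\}$ of integers (with distinct $a_i$) and a positive integer $h$, the restricted $h$-fold signed sumset is \[h^{\wedge}_{\pm}A = \left\{ \sum_{i=1}^{k} \lambda_i a_i : \lambda_i \in \{-1,0,1\}, \ \sum_{i=1}^{k} |\lambda_i| = h \right\}.\] $-A = \{-a : a \in A\}$, $A_{abs} = \{|a| : a \in A\}$, and for an integer $c$ and a set $S$ of integers, $c \ast S = \{cs : s \in S\}$. *)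

theory Defs
  imports Main
begin

text \<open>The coefficient \<open>\<lambda>\<^sub>i\<close> of \<open>a\<^sub>i\<close> is given by a function \<open>l\<close> on the elements of \<open>A\<close>
  themselves, which are pairwise distinct; values of \<open>l\<close> outside \<open>A\<close> play no role.\<close>

definition restricted_signed_sumset :: "nat \<Rightarrow> int set \<Rightarrow> int set" where
  "restricted_signed_sumset h A =
     {\<Sum>a\<in>A. l a * a | l :: int \<Rightarrow> int.
        (\<forall>a\<in>A. l a \<in> {-1, 0, 1}) \<and> (\<Sum>a\<in>A. \<bar>l a\<bar>) = int h}"

definition A_abs :: "int set \<Rightarrow> int set" where
  "A_abs A = {\<bar>a\<bar> | a. a \<in> A}"

definition dilate :: "int \<Rightarrow> int set \<Rightarrow> int set" where
  "dilate c S = {c * s | s. s \<in> S}"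

end

theory Submission
  imports Defs
begin

text \<open>
  Replacing \<open>A\<close> by \<open>A_abs A\<close>, assume \<open>0 < a\<^sub>1 < \<dots> < a\<^sub>k\<close>. The theorem is the equality case of
  \<open>|h^\<plusminus>A| \<ge> 2hk - h\<^sup>2 + 1\<close>, proved by removing the largest element. For \<open>k > h + 1\<close> the element
  \<open>a\<^sub>k\<close> contributes the \<open>h\<close> new sums obtained from the top \<open>h + 1\<close> elements by omitting one
  of them other than \<open>a\<^sub>k\<close>, and their negatives.

  For \<open>n = k = h + 1\<close> the sums are, up to translation, the numbers \<open>a + 2\<Sum>F\<close> with
  \<open>a \<in> A\<close> and \<open>F \<subseteq> A - {a}\<close>, and one needs \<open>n\<^sup>2\<close> of them. Those with \<open>a\<^sub>n \<in> F\<close> form a translate of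
  the set belonging to \<open>A - {a\<^sub>n}\<close> and are at least \<open>2a\<^sub>n + a\<^sub>1\<close>, so \<open>2n - 1\<close> smaller ones are needed:
  the elements of \<open>A\<close> and \<open>n - 1\<close> numbers \<open>2a\<^sub>i + a\<^sub>j\<close> strictly between \<open>a\<^sub>n\<close> and \<open>2a\<^sub>n + a\<^sub>1\<close>. To find
  the latter, translate \<open>a\<^sub>1\<close> to \<open>0\<close> and work modulo \<open>N = a\<^sub>n - a\<^sub>1\<close>: every residue \<open>2y\<close> is attained. If
  doubling is not injective, then \<open>N = 2D\<close> and some \<open>x\<close> and \<open>x + D\<close> are both present; then the residues
  \<open>2x + z\<close> are attained for all \<open>z\<close> with at most one exception, and looking at the nearest
  neighbours of the exceptional point yields one further residue. The bound fails for \<open>n = 3\<close>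
  (exactly at \<open>{d, 3d, 5d}\<close>), so the induction starts at \<open>n = 4\<close>.
\<close>

subsection \<open>Doubling in an interval\<close>

text \<open>Supplies the two neighbours \<open>p\<close> and \<open>q\<close> of an exceptional
  point \<open>w\<close>; any later construction of a point strictly between them, other than
  \<open>w\<close>, is a contradiction.\<close>

lemma nearest_below_above:
  fixes C :: "int set"
  assumes "finite C" "l \<in> C" "l < w" "w < N"
  shows "\<exists>p\<in>C. \<exists>q\<in>insert N C. l \<le> p \<and> p < w \<and> w < q \<and> q \<le> N \<and>
    (\<forall>c\<in>insert N C. c \<le> p \<or> c = w \<or> q \<le> c)"
proof -
  define P where "P = {c \<in> C. c < w}"
  define Q where "Q = {c \<in> insert N C. w < c}"
  have "finite P" "l \<in> P" "finite Q" "N \<in> Q" using assms by (auto simp: P_def Q_def)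
  have P: "Max P \<in> P" and Q: "Min Q \<in> Q"
    using Max_in[OF \<open>finite P\<close>] Min_in[OF \<open>finite Q\<close>] \<open>l \<in> P\<close> \<open>N \<in> Q\<close> by blast+
  have "l \<le> Max P" "Min Q \<le> N" using \<open>finite P\<close> \<open>l \<in> P\<close> \<open>finite Q\<close> \<open>N \<in> Q\<close> by auto
  moreover have "\<forall>c\<in>insert N C. c \<le> Max P \<or> c = w \<or> Min Q \<le> c"
  proof
    fix c assume c: "c \<in> insert N C"
    show "c \<le> Max P \<or> c = w \<or> Min Q \<le> c"
    proof (cases "c < w")
      case True
      then have "c \<in> P" using c \<open>w < N\<close> by (auto simp: P_def)
      then show ?thesis using \<open>finite P\<close> by simp
    next
      case False
      then have "c = w \<or> c \<in> Q" using c by (auto simp: Q_def)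
      then show ?thesis using \<open>finite Q\<close> by auto
    qed
  qed
  moreover have "Max P \<in> C" "Max P < w" "Min Q \<in> insert N C" "w < Min Q"
    using P Q by (simp_all add: P_def Q_def)
  ultimately show ?thesis by blast
qed

text \<open>Put \<open>w = x + D\<close>. Since \<open>2 * w\<close> and \<open>2 * x\<close> agree
  modulo \<open>2 * D\<close>, \<open>cl\<close> says that \<open>2 * (y - w) + z\<close>, reduced
  modulo \<open>2 * D\<close>, lies in \<open>C\<close> but is not \<open>w\<close>. For the
  neighbours \<open>p\<close>, \<open>q\<close> of \<open>w\<close>, unequal gaps yield such a point
  strictly between \<open>p\<close> and \<open>q\<close>. Equal gaps lead either to \<open>w\<close>
  itself or to a point inside a gap.\<close>

lemma doubling_closed_low:
  fixes C :: "int set"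
  assumes fin: "finite C" and C: "C \<subseteq> {0..<2 * D}" and "0 \<in> C" and card: "3 \<le> card C"
    and x: "x \<in> C" and w: "x + D \<in> C" and x3: "3 * x < D"
    and cl: "\<And>y z. y \<in> C \<Longrightarrow> z \<in> insert (2 * D) C \<Longrightarrow> y \<noteq> z \<Longrightarrow> 2 * D \<le> 2 * y + z \<Longrightarrow>
      2 * y + z < 4 * D \<Longrightarrow>
      2 * y + z - 2 * x \<in> C - {x + D} \<or> 2 * y + z - 2 * x - 2 * D \<in> C - {x + D}"
  shows False
proof -
  have rng: "0 \<le> c" "c < 2 * D" if "c \<in> C" for c using C that by auto
  have x0: "0 \<le> x" "0 < D" using rng[OF x] by auto
  obtain p q where p: "p \<in> C" "p < x + D" "x \<le> p" and q: "q \<in> insert (2 * D) C" "x + D < q" "q \<le> 2 * D"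
    and pq: "\<And>c. c \<in> insert (2 * D) C \<Longrightarrow> c \<le> p \<or> c = x + D \<or> q \<le> c"
    using nearest_below_above[OF fin x, of "x + D" "2 * D"] x0 x3 by (smt (verit))
  \<comment> \<open>For \<open>x > 0\<close> the pair \<open>y = 0\<close>, \<open>z = 2 * D\<close>
    puts \<open>2 * D - 2 * x\<close> into \<open>C\<close>, and \<open>3 * x < D\<close> places it
    above \<open>x + D\<close>. The bound helps to keep the later sums below
    \<open>4 * D\<close>.\<close>
  have "q \<le> 2 * D - 2 * x"
  proof (cases "x = 0")
    case False
    have "2 * D - 2 * x \<in> C" using cl[of 0 "2 * D"] \<open>0 \<in> C\<close> x0 False rng[of "-2 * x"] by auto
    then show ?thesis using pq[of "2 * D - 2 * x"] p x3 by auto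
  qed (use q in auto)
  consider "q - (x + D) < x + D - p" | "x + D - p < q - (x + D)" | "q - (x + D) = x + D - p" by linarith
  then show False
  proof cases
    case 1
    have "q \<noteq> 2 * D" using 1 p x0 \<open>q \<le> 2 * D - 2 * x\<close> by auto
    then have "q \<in> C" using q by auto
    have "2 * q + p - 2 * x \<in> C - {x + D} \<or> 2 * q + p - 2 * x - 2 * D \<in> C - {x + D}"
      by (rule cl) (use \<open>q \<in> C\<close> p q 1 x0 x3 \<open>q \<le> 2 * D - 2 * x\<close> in auto)
    then show False
      using pq[of "2 * q + p - 2 * x - 2 * D"] rng[of "2 * q + p - 2 * x"] 1 p q x0 by auto
  next
    case 2
    have "2 * p + q - 2 * x \<in> C - {x + D} \<or> 2 * p + q - 2 * x - 2 * D \<in> C - {x + D}"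
      by (rule cl) (use p q 2 x0 x3 \<open>q \<le> 2 * D - 2 * x\<close> in auto)
    then show False
      using pq[of "2 * p + q - 2 * x - 2 * D"] rng[of "2 * p + q - 2 * x"] 2 p q x0 by auto
  next
    case 3
    show False
    proof (cases "q = 2 * D")
      case True
      then have "x = 0" "p = 0" using \<open>q \<le> 2 * D - 2 * x\<close> x0 3 by auto
      \<comment> \<open>The set \<open>{0, D}\<close> does satisfy \<open>cl\<close> with
        \<open>x = 0\<close>; this is why three elements are assumed.\<close>
      have "C \<subseteq> {0, D}"
      proof
        fix c assume "c \<in> C"
        then show "c \<in> {0, D}" using pq[of c] rng[of c] True \<open>x = 0\<close> \<open>p = 0\<close> by auto
      qed
      then have "card C \<le> card {0, D}" by (intro card_mono) auto
      also have "\<dots> \<le> 2" by (simp add: card_insert_if)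
      finally show False using card by simp
    next
      case False
      then have "q \<in> C" using q by auto
      show False
      proof (cases "2 * (q - (x + D)) \<le> D")
        case True
        \<comment> \<open>Let \<open>e\<close> be the common gap and \<open>w = x + D\<close>. The
          sum \<open>2 * p + w\<close> reduces to \<open>w - 2 * e\<close>, and then
          \<open>2 * q + (w - 2 * e)\<close> reduces to the excluded point \<open>w\<close>.\<close>
        have "2 * p + (x + D) - 2 * x \<in> C - {x + D} \<or> 2 * p + (x + D) - 2 * x - 2 * D \<in> C - {x + D}"
          by (rule cl) (use p q w 3 x0 x3 True in auto)
        then have *: "2 * p - x - D \<in> C"
          using rng[of "2 * p + (x + D) - 2 * x"] True p 3 x0 by (auto simp: algebra_simps)
        have "2 * q + (2 * p - x - D) - 2 * x \<in> C - {x + D}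
            \<or> 2 * q + (2 * p - x - D) - 2 * x - 2 * D \<in> C - {x + D}"
          by (rule cl) (use p q * \<open>q \<in> C\<close> 3 x0 x3 True in auto)
        moreover have "2 * q + (2 * p - x - D) - 2 * x = x + 3 * D" using 3 by simp
        ultimately show False using rng[of "x + 3 * D"] x0 by auto
      next
        case nle: False
        have lt: "q < x + 2 * D" using q False x0 \<open>q \<le> 2 * D - 2 * x\<close> by auto
        \<comment> \<open>With common gap \<open>e\<close>, where \<open>D < 2 * e\<close> and
          \<open>e < D\<close>, this sum reduces to \<open>x + 2 * e\<close>, strictly between
          \<open>x + D\<close> and \<open>q\<close>.\<close>
        have "2 * q + x - 2 * x \<in> C - {x + D} \<or> 2 * q + x - 2 * x - 2 * D \<in> C - {x + D}"
          by (rule cl) (use p q x \<open>q \<in> C\<close> 3 x0 x3 nle \<open>q \<le> 2 * D - 2 * x\<close> lt in auto)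
        then show False
          using pq[of "2 * q + x - 2 * x - 2 * D"] rng[of "2 * q + x - 2 * x"] nle lt p q x0 by auto
      qed
    qed
  qed
qed

text \<open>The counterpart of \<open>doubling_closed_low\<close> with \<open>x\<close> itself as
  the exceptional point; the same comparison of gaps applies, now around \<open>x\<close>.\<close>

lemma doubling_closed_high:
  fixes C :: "int set"
  assumes fin: "finite C" and C: "C \<subseteq> {0..<2 * D}" and "0 \<in> C"
    and x: "x \<in> C" and w: "x + D \<in> C" and x3: "2 * D \<le> 3 * x"
    and cl: "\<And>y z. y \<in> C \<Longrightarrow> z \<in> insert (2 * D) C \<Longrightarrow> y \<noteq> z \<Longrightarrow> 2 * D \<le> 2 * y + z \<Longrightarrow>
      2 * y + z < 4 * D \<Longrightarrow>
      2 * y + z - 2 * x \<in> C - {x} \<or> 2 * y + z - 2 * x - 2 * D \<in> C - {x}"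
  shows False
proof -
  have rng: "0 \<le> c" "c < 2 * D" if "c \<in> C" for c using C that by auto
  have x0: "0 < x" "x < D" "0 < D" using rng[OF x] rng[OF w] x3 by auto
  obtain p q where p: "p \<in> C" "p < x" "0 \<le> p" and q: "q \<in> insert (2 * D) C" "x < q"
    and pq: "\<And>c. c \<in> insert (2 * D) C \<Longrightarrow> c \<le> p \<or> c = x \<or> q \<le> c"
    using nearest_below_above[OF fin \<open>0 \<in> C\<close>, of x "2 * D"] x0 x3 by (smt (verit))
  have "q \<le> x + D" using pq[of "x + D"] w p x0 by auto
  then have "q \<in> C" using q x0 by auto
  \<comment> \<open>Again \<open>y = 0\<close>, \<open>z = 2 * D\<close>. Since \<open>x\<close> is
    excluded, \<open>2 * D \<le> 3 * x\<close> becomes strict, and the resulting lower bound for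
    \<open>p\<close> keeps the later sums at least \<open>2 * D\<close>.\<close>
  have m: "2 * D - 2 * x \<in> C - {x}" using cl[of 0 "2 * D"] \<open>0 \<in> C\<close> x0 rng[of "-2 * x"] by auto
  then have lt: "2 * D < 3 * x" using x3 by auto
  then have p2: "2 * D - 2 * x \<le> p" using pq[of "2 * D - 2 * x"] m q by auto
  consider "q - x < x - p" | "x - p < q - x" | "q - x = x - p" by linarith
  then show False
  proof cases
    case 1
    have "2 * q + p - 2 * x \<in> C - {x} \<or> 2 * q + p - 2 * x - 2 * D \<in> C - {x}"
      by (rule cl) (use \<open>q \<in> C\<close> p q 1 x0 x3 p2 in auto)
    then show False
      using pq[of "2 * q + p - 2 * x"] rng[of "2 * q + p - 2 * x - 2 * D"] 1 p q x0 by auto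
  next
    case 2
    have "2 * p + q - 2 * x \<in> C - {x} \<or> 2 * p + q - 2 * x - 2 * D \<in> C - {x}"
      by (rule cl) (use p q 2 x0 x3 p2 \<open>q \<le> x + D\<close> in auto)
    then show False
      using pq[of "2 * p + q - 2 * x"] rng[of "2 * p + q - 2 * x - 2 * D"] 2 p q x0 \<open>q \<le> x + D\<close> by auto
  next
    case 3
    show False
    proof (cases "2 * (q - x) \<le> D")
      case True
      have "2 * q + x - 2 * x \<in> C - {x} \<or> 2 * q + x - 2 * x - 2 * D \<in> C - {x}"
        by (rule cl) (use p q x \<open>q \<in> C\<close> 3 x0 x3 True in auto)
      then have *: "2 * q - x \<in> C"
        using rng[of "2 * q + x - 2 * x - 2 * D"] True p q 3 x0 by (auto simp: algebra_simps)
      have "2 * p + (2 * q - x) - 2 * x \<in> C - {x} \<or> 2 * p + (2 * q - x) - 2 * x - 2 * D \<in> C - {x}"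
        by (rule cl) (use p q * 3 x0 x3 True in auto)
      moreover have "2 * p + (2 * q - x) - 2 * x = x" using 3 by simp
      ultimately show False using rng[of "x - 2 * D"] x0 by auto
    next
      case False
      \<comment> \<open>With common gap \<open>e\<close>, this reduces to
        \<open>x + D - 2 * e\<close>, strictly between \<open>p\<close> and \<open>x\<close>: here
        \<open>D < 2 * e\<close>, while \<open>e < D\<close> follows from
        \<open>2 * D - 2 * x \<le> p\<close> and \<open>x < D\<close>.\<close>
      have "2 * p + (x + D) - 2 * x \<in> C - {x} \<or> 2 * p + (x + D) - 2 * x - 2 * D \<in> C - {x}"
        by (rule cl) (use p q w 3 x0 x3 p2 False in auto)
      then show False
        using pq[of "2 * p + (x + D) - 2 * x"] rng[of "2 * p + (x + D) - 2 * x - 2 * D"]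
          False lt p2 3 p q x0 by auto
    qed
  qed
qed

text \<open>The window from \<open>N\<close> to \<open>2 * N\<close> contains each residue modulo
  \<open>N\<close> once, so attained residues are counted: the doubles of \<open>C\<close> if they
  are distinct, and otherwise a translate of \<open>C\<close> with at most one point
  missing.\<close>

lemma card_double_plus_ge:
  fixes C :: "int set"
  assumes fin: "finite C" and C: "C \<subseteq> {0..<N}" and "0 \<in> C" and card: "3 \<le> card C"
  shows "card C \<le> card {r. \<exists>y z. y \<in> C \<and> z \<in> insert N C \<and> y \<noteq> z \<and> r = 2 * y + z \<and> N \<le> r \<and> r < 2 * N}"
    (is "_ \<le> card ?S")
proof -
  define R where "R = ?S"
  have finR: "finite R" unfolding R_def by (rule finite_subset[of _ "{N..<2 * N}"]) auto
  have rng: "0 \<le> c" "c < N" if "c \<in> C" for c using C that by auto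
  have N0: "0 < N" using rng[OF \<open>0 \<in> C\<close>] by auto
  have RI: "2 * y + z \<in> R" if "y \<in> C" "z \<in> insert N C" "y \<noteq> z" "N \<le> 2 * y + z" "2 * y + z < 2 * N" for y z
    using that unfolding R_def by blast
  \<comment> \<open>Both \<open>0\<close> and \<open>N\<close> represent residue zero, so one of
    them as \<open>z\<close> brings \<open>2 * y\<close> into the window.\<close>
  define \<phi> where "\<phi> = (\<lambda>y. if 2 * y < N then 2 * y + N else 2 * y + 0)"
  have \<phi>: "\<phi> ` C \<subseteq> R"
  proof
    fix r assume "r \<in> \<phi> ` C"
    then obtain y where y: "y \<in> C" "r = \<phi> y" by auto
    then show "r \<in> R" unfolding y(2) \<phi>_def
      using RI[of y N] RI[of y 0] rng[OF y(1)] \<open>0 \<in> C\<close> N0 by auto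
  qed
  have "card C \<le> card R"
  proof (cases "inj_on \<phi> C")
    case True
    then show "card C \<le> card R" using card_mono[OF finR \<phi>] card_image[of \<phi> C] by simp
  next
    case False
    then obtain u v where uv: "u \<in> C" "v \<in> C" "\<phi> u = \<phi> v" "u < v"
      unfolding inj_on_def by (metis linorder_neqE_linordered_idom)
    define x D where "x = u" and "D = v - u"
    have N: "N = 2 * D" and x: "x \<in> C" and w: "x + D \<in> C"
      using uv by (auto simp: x_def D_def \<phi>_def split: if_splits)
    have x0: "0 \<le> x" "x < D" using rng[OF x] rng[OF w] N by auto
    \<comment> \<open>The elements \<open>x\<close> and \<open>x + D\<close> have the same double
      modulo \<open>2 * D\<close>; the one that brings the sum into the window is used. The sum is
      admissible unless this element equals \<open>z\<close>.\<close>
    define \<psi> where "\<psi> = (\<lambda>z. if 2 * D \<le> 2 * x + z then 2 * x + z else 2 * (x + D) + z)"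
    have inj: "inj_on \<psi> C"
    proof (rule inj_onI)
      fix a b assume "a \<in> C" "b \<in> C" "\<psi> a = \<psi> b"
      then show "a = b" using rng[of a] rng[of b] N by (auto simp: \<psi>_def split: if_splits)
    qed
    have \<psi>R: "\<psi> z \<in> R" if "z \<in> C" "z = x \<longrightarrow> 3 * x < 2 * D" "z = x + D \<longrightarrow> D \<le> 3 * x" for z
      unfolding \<psi>_def using RI[of x z] RI[of "x + D" z] that rng[of z] x w x0 N by auto
    \<comment> \<open>If the count fell short, the \<open>card C - 1\<close> values of
      \<open>\<psi>\<close> away from \<open>m\<close> would exhaust \<open>R\<close>. Every
      admissible sum would then be one of them, which is the closure property \<open>cl\<close>
      refuted above.\<close>
    have no: False if m: "m \<in> C" "\<psi> ` (C - {m}) \<subseteq> R" "card R < card C"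
      and cont: "(\<And>y z. y \<in> C \<Longrightarrow> z \<in> insert (2 * D) C \<Longrightarrow> y \<noteq> z \<Longrightarrow> 2 * D \<le> 2 * y + z \<Longrightarrow>
        2 * y + z < 4 * D \<Longrightarrow>
        2 * y + z - 2 * x \<in> C - {m} \<or> 2 * y + z - 2 * x - 2 * D \<in> C - {m}) \<Longrightarrow> False" for m
    proof (rule cont)
      have "card (\<psi> ` (C - {m})) = card C - 1"
        using inj m(1) fin by (subst card_image) (auto intro: inj_on_subset)
      then have eq: "\<psi> ` (C - {m}) = R"
        using m finR by (intro card_seteq) auto
      fix y z assume "y \<in> C" "z \<in> insert (2 * D) C" "y \<noteq> z" "2 * D \<le> 2 * y + z" "2 * y + z < 4 * D"
      then have "2 * y + z \<in> \<psi> ` (C - {m})" using RI[of y z] eq N by auto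
      then obtain c where "c \<in> C - {m}" "2 * y + z = \<psi> c" by auto
      then show "2 * y + z - 2 * x \<in> C - {m} \<or> 2 * y + z - 2 * x - 2 * D \<in> C - {m}"
        by (auto simp: \<psi>_def split: if_splits)
    qed
    \<comment> \<open>A coincidence with \<open>z\<close> occurs at \<open>x + D\<close> if
      \<open>3 * x < D\<close>, at \<open>x\<close> if \<open>2 * D \<le> 3 * x\<close>, and nowhere
      in between.\<close>
    consider "D \<le> 3 * x" "3 * x < 2 * D" | "3 * x < D" | "2 * D \<le> 3 * x" by linarith
    then show "card C \<le> card R"
    proof cases
      case 1
      then have "\<psi> ` C \<subseteq> R" using \<psi>R by blast
      then show "card C \<le> card R" using card_mono[OF finR] card_image[OF inj] by metis
    next
      case 2
      have "\<psi> ` (C - {x + D}) \<subseteq> R" using \<psi>R 2 x0 by fastforce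
      then show "card C \<le> card R"
        using no[OF w] doubling_closed_low[OF fin _ \<open>0 \<in> C\<close> card x w 2] C N by (meson not_le)
    next
      case 3
      have "\<psi> ` (C - {x}) \<subseteq> R" using \<psi>R 3 x0 by fastforce
      then show "card C \<le> card R"
        using no[OF x] doubling_closed_high[OF fin _ \<open>0 \<in> C\<close> x w 3] C N by (meson not_le)
    qed
  qed
  then show ?thesis by (simp add: R_def)
qed

subsection \<open>Sums omitting one element\<close>

text \<open>A signed sum with coefficient 0 at \<open>a\<close>, 1 on \<open>F\<close> and -1
  elsewhere, translated by \<open>\<Sum>A\<close>.\<close>

definition omit_one_sums :: "int set \<Rightarrow> int set" where
  "omit_one_sums A = {a + 2 * \<Sum>F | a F. a \<in> A \<and> F \<subseteq> A - {a}}"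

text \<open>Used both for the extremal sets and, with \<open>n\<^sup>2\<close> in place of
  \<open>n\<close>, for their sums.\<close>

definition odd_multiples :: "int \<Rightarrow> nat \<Rightarrow> int set" where
  "odd_multiples d n = (\<lambda>i. d * (2 * int i - 1)) ` {1..n}"

lemma omit_one_sumsI: "a \<in> A \<Longrightarrow> F \<subseteq> A \<Longrightarrow> a \<notin> F \<Longrightarrow> r = a + 2 * \<Sum>F \<Longrightarrow> r \<in> omit_one_sums A"
  unfolding omit_one_sums_def by auto

lemma finite_omit_one_sums: "finite A \<Longrightarrow> finite (omit_one_sums A)"
  by (rule finite_subset[of _ "(\<lambda>(a, F). a + 2 * \<Sum>F) ` (A \<times> Pow A)"])
    (auto simp: omit_one_sums_def)

lemma omit_one_sums_mono: "A \<subseteq> B \<Longrightarrow> omit_one_sums A \<subseteq> omit_one_sums B"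
  unfolding omit_one_sums_def by blast

lemma omit_one_sums_insert:
  assumes "finite A" "m \<notin> A" "r \<in> omit_one_sums A"
  shows "2 * m + r \<in> omit_one_sums (insert m A)"
proof -
  obtain a F where aF: "a \<in> A" "F \<subseteq> A - {a}" "r = a + 2 * \<Sum>F"
    using assms by (auto simp: omit_one_sums_def)
  have "m \<notin> F" "finite F" using aF assms finite_subset by blast+
  then show ?thesis using aF assms
    by (intro omit_one_sumsI[of a _ "insert m F"]) auto
qed

text \<open>Exchange \<open>F\<close> with its complement in \<open>A - {a}\<close>, that is, change
  all signs.\<close>

lemma omit_one_sums_reflect:
  assumes "finite A" "r \<in> omit_one_sums A"
  shows "2 * \<Sum>A - r \<in> omit_one_sums A"
proof -
  obtain a F where aF: "a \<in> A" "F \<subseteq> A - {a}" "r = a + 2 * \<Sum>F"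
    using assms by (auto simp: omit_one_sums_def)
  have "\<Sum>(A - {a} - F) = \<Sum>A - a - \<Sum>F"
    using aF assms by (simp add: sum_diff sum_diff1 finite_subset)
  then show ?thesis using aF by (intro omit_one_sumsI[of a _ "A - {a} - F"]) auto
qed

section \<open>Removing the largest element\<close>

lemma omit_one_sums_ge:
  assumes "finite A" "\<And>a. a \<in> A \<Longrightarrow> 0 < a" "r \<in> omit_one_sums A"
  shows "Min A \<le> r"
proof -
  obtain a F where aF: "a \<in> A" "F \<subseteq> A - {a}" "r = a + 2 * \<Sum>F"
    using assms by (auto simp: omit_one_sums_def)
  have "0 \<le> \<Sum>F" using aF assms by (intro sum_nonneg) force
  moreover have "Min A \<le> a" using aF assms by simp
  ultimately show ?thesis using aF by linarith
qed

text \<open>Translation by \<open>l = Min A\<close> turns \<open>A - {m}\<close> into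
  \<open>C\<close> and \<open>m\<close> into \<open>N\<close>, so that \<open>2 * y + z\<close>
  stands for the sum \<open>2 * y + z + 3 * l\<close>. These sums are at least
  \<open>m + 2 * l\<close>, hence not in \<open>A\<close>. The condition
  \<open>4 \<le> card A\<close> provides the three elements needed in \<open>C\<close>.\<close>

lemma card_omit_one_sums_low:
  assumes fin: "finite A" and pos: "\<And>a. a \<in> A \<Longrightarrow> 0 < a" and n: "4 \<le> card A"
  shows "2 * card A - 1 \<le> card {r \<in> omit_one_sums A. r < 2 * Max A + Min A}" (is "_ \<le> card ?L")
proof -
  define m l where "m = Max A" and "l = Min A"
  have "A \<noteq> {}" using n by auto
  have ml: "m \<in> A" "l \<in> A" and bd: "\<And>a. a \<in> A \<Longrightarrow> l \<le> a \<and> a \<le> m"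
    using fin \<open>A \<noteq> {}\<close> by (auto simp: m_def l_def)
  have "m \<noteq> l"
  proof
    assume "m = l"
    then have "A \<subseteq> {m}" using bd by force
    then have "card A \<le> card {m}" by (intro card_mono) auto
    then show False using n by simp
  qed
  define C where "C = (\<lambda>a. a - l) ` (A - {m})"
  define N where "N = m - l"
  define R where "R = {r. \<exists>y z. y \<in> C \<and> z \<in> insert N C \<and> y \<noteq> z \<and> r = 2 * y + z \<and> N \<le> r \<and> r < 2 * N}"
  have CD: "y + l \<in> A" "y \<noteq> N" if "y \<in> C" for y using that by (auto simp: C_def N_def)
  have cardC: "card C = card A - 1" unfolding C_def
    using fin ml by (subst card_image) (auto simp: inj_on_def)
  have "C \<subseteq> {0..<N}" using bd by (force simp: C_def N_def)
  moreover have "0 \<in> C" using ml \<open>m \<noteq> l\<close> by (force simp: C_def)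
  ultimately have "card C \<le> card R" unfolding R_def
    using fin cardC n by (intro card_double_plus_ge) (auto simp: C_def)
  moreover have finR: "finite R"
    by (rule finite_subset[of _ "{N..<2 * N}"]) (auto simp: R_def)
  moreover have RL: "(\<lambda>r. r + 3 * l) ` R \<subseteq> ?L"
  proof
    fix s assume "s \<in> (\<lambda>r. r + 3 * l) ` R"
    then obtain y z where yz: "y \<in> C" "z \<in> insert N C" "y \<noteq> z" "s = 2 * y + z + 3 * l" "2 * y + z < 2 * N"
      by (auto simp: R_def)
    have "s \<in> omit_one_sums A"
      by (rule omit_one_sumsI[of "z + l" _ "{y + l}"]) (use yz CD ml in \<open>auto simp: N_def\<close>)
    then show "s \<in> ?L" using yz by (auto simp: N_def m_def l_def)
  qed
  moreover have AL: "A \<subseteq> ?L"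
  proof
    fix a assume a: "a \<in> A"
    then have "a \<in> omit_one_sums A" by (intro omit_one_sumsI[of a _ "{}"]) auto
    then show "a \<in> ?L" using bd[OF a] pos[OF ml(1)] pos[OF ml(2)] by (simp add: m_def l_def)
  qed
  moreover have "A \<inter> (\<lambda>r. r + 3 * l) ` R = {}"
    using bd pos[OF ml(2)] by (force simp: R_def N_def)
  moreover have "finite ?L" using finite_omit_one_sums[OF fin] by simp
  ultimately have "card A + card ((\<lambda>r. r + 3 * l) ` R) \<le> card ?L"
    using fin by (subst card_Un_disjoint[symmetric]) (auto intro!: card_mono)
  moreover have "card ((\<lambda>r. r + 3 * l) ` R) = card R"
    by (rule card_image) (auto simp: inj_on_def)
  ultimately show ?thesis using \<open>card C \<le> card R\<close> cardC n by linarith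
qed

lemma card_omit_one_sums_step:
  assumes fin: "finite A" and pos: "\<And>a. a \<in> A \<Longrightarrow> 0 < a" and n: "4 \<le> card A"
  shows "card (omit_one_sums (A - {Max A})) + 2 * card A - 1 \<le> card (omit_one_sums A)"
proof -
  define m where "m = Max A"
  define L where "L = {r \<in> omit_one_sums A. r < 2 * m + Min A}"
  have "A \<noteq> {}" using n by auto
  then have m: "m \<in> A" using fin by (simp add: m_def)
  have ne: "A - {m} \<noteq> {}" using n card_mono[of "{m}" A] by auto
  have finX: "finite (omit_one_sums A)" "finite (omit_one_sums (A - {m}))" using fin by (auto intro: finite_omit_one_sums)
  let ?U = "(\<lambda>r. 2 * m + r) ` omit_one_sums (A - {m})"
  have "?U \<subseteq> omit_one_sums A"
    using omit_one_sums_insert[of "A - {m}" m] fin m by (auto simp: insert_absorb)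
  moreover have "2 * m + Min A \<le> r" if "r \<in> ?U" for r
  proof -
    obtain s where s: "s \<in> omit_one_sums (A - {m})" "r = 2 * m + s" using \<open>r \<in> ?U\<close> by auto
    have "Min A \<le> Min (A - {m})" using fin ne by (intro Min_antimono) auto
    also have "\<dots> \<le> s" using fin pos s by (intro omit_one_sums_ge) auto
    finally show ?thesis using s by simp
  qed
  then have "L \<inter> ?U = {}" by (force simp: L_def)
  ultimately have "card L + card ?U \<le> card (omit_one_sums A)"
    using finX by (subst card_Un_disjoint[symmetric]) (auto simp: L_def intro!: card_mono)
  moreover have "card ?U = card (omit_one_sums (A - {m}))" by (rule card_image) (auto simp: inj_on_def)
  ultimately show ?thesis using card_omit_one_sums_low[OF assms] n by (simp add: L_def m_def)
qed

section \<open>Explicit counts for small sets\<close>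

lemma card_omit_one_sums_half:
  assumes "finite A" "L \<subseteq> omit_one_sums A" "\<And>r. r \<in> L \<Longrightarrow> r < \<Sum>A"
  shows "2 * card L \<le> card (omit_one_sums A)"
proof -
  let ?U = "(\<lambda>r. 2 * \<Sum>A - r) ` L"
  have fin: "finite (omit_one_sums A)" "finite L"
    using assms finite_omit_one_sums finite_subset by blast+
  have "L \<union> ?U \<subseteq> omit_one_sums A" using assms(2) omit_one_sums_reflect[OF assms(1)] by auto
  then have "card (L \<union> ?U) \<le> card (omit_one_sums A)" using fin by (intro card_mono)
  moreover have "L \<inter> ?U = {}"
  proof (rule equals0I)
    fix r assume "r \<in> L \<inter> ?U"
    then obtain s where "r \<in> L" "s \<in> L" "r = 2 * \<Sum>A - s" by auto
    then show False using assms(3)[of r] assms(3)[of s] by simp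
  qed
  moreover have "card ?U = card L" by (rule card_image) (auto simp: inj_on_def)
  ultimately show ?thesis using fin by (simp add: card_Un_disjoint)
qed

text \<open>Five sums below the centre \<open>a + b + c\<close> are doubled by reflection. The
  fifth, \<open>e\<close>, is \<open>b + 2 * a\<close> unless this equals \<open>c\<close>; then it
  is \<open>a + 2 * b\<close>, which meets \<open>c + 2 * a\<close> only for
  \<open>b = 3 * a\<close> and \<open>c = 5 * a\<close>.\<close>

lemma card_omit_one_sums_three:
  fixes a b c :: int
  assumes "0 < a" "a < b" "b < c" "\<not> (b = 3 * a \<and> c = 5 * a)"
  shows "10 \<le> card (omit_one_sums {a, b, c})"
proof -
  let ?X = "omit_one_sums {a, b, c}"
  have X: "a \<in> ?X" "b \<in> ?X" "c \<in> ?X" "c + 2 * a \<in> ?X" "b + 2 * a \<in> ?X" "a + 2 * b \<in> ?X"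
    using assms omit_one_sumsI[of a "{a, b, c}" "{}"] omit_one_sumsI[of b "{a, b, c}" "{}"]
      omit_one_sumsI[of c "{a, b, c}" "{}"] omit_one_sumsI[of c "{a, b, c}" "{a}"]
      omit_one_sumsI[of b "{a, b, c}" "{a}"] omit_one_sumsI[of a "{a, b, c}" "{b}"] by auto
  obtain e where e: "e \<in> {b + 2 * a, a + 2 * b}" "e \<notin> {a, b, c, c + 2 * a}"
  proof (cases "b + 2 * a = c")
    case True
    then show ?thesis using assms by (intro that[of "a + 2 * b"]) auto
  next
    case False
    then show ?thesis using assms by (intro that[of "b + 2 * a"]) auto
  qed
  have "2 * card {e, a, b, c, c + 2 * a} \<le> card ?X"
    by (rule card_omit_one_sums_half) (use X e assms in auto)
  moreover have "card {e, a, b, c, c + 2 * a} = 5" using e assms by auto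
  ultimately show ?thesis by simp
qed

text \<open>The set \<open>{d, 3 * d, 5 * d}\<close> has only 8 sums, \<open>9 * d\<close> being
  missed, so \<open>card_omit_one_sums_step\<close> would give just 15. The sums are therefore
  listed according to whether \<open>m\<close> is outside \<open>F\<close> but not omitted
  (\<open>Y1\<close>), in \<open>F\<close> (\<open>Y2\<close>) or omitted
  (\<open>Z\<close>).\<close>

lemma card_omit_one_sums_1_3_5:
  fixes d m :: int
  assumes d: "0 < d" and m: "5 * d < m"
  shows "16 \<le> card (omit_one_sums {d, 3 * d, 5 * d, m})"
    and "m \<noteq> 7 * d \<Longrightarrow> 17 \<le> card (omit_one_sums {d, 3 * d, 5 * d, m})"
proof -
  let ?A = "{d, 3 * d, 5 * d, m}"
  let ?X = "omit_one_sums ?A"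
  have fin: "finite ?X" by (rule finite_omit_one_sums) simp
  have Y: "(\<lambda>i. i * d) ` {1, 3, 5, 7, 11, 13, 15, 17} \<subseteq> omit_one_sums {d, 3 * d, 5 * d}"
    using d omit_one_sumsI[of d "{d, 3 * d, 5 * d}" "{}"] omit_one_sumsI[of "3 * d" "{d, 3 * d, 5 * d}" "{}"]
      omit_one_sumsI[of "5 * d" "{d, 3 * d, 5 * d}" "{}"] omit_one_sumsI[of "d" "{d, 3 * d, 5 * d}" "{3 * d}"]
      omit_one_sumsI[of d "{d, 3 * d, 5 * d}" "{5 * d}"] omit_one_sumsI[of "3 * d" "{d, 3 * d, 5 * d}" "{5 * d}"]
      omit_one_sumsI[of "3 * d" "{d, 3 * d, 5 * d}" "{d, 5 * d}"]
      omit_one_sumsI[of "d" "{d, 3 * d, 5 * d}" "{3 * d, 5 * d}"] by auto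
  have Y1: "(\<lambda>i. i * d) ` {1, 3, 5, 7, 11, 13, 15, 17} \<subseteq> ?X"
    using Y omit_one_sums_mono[of "{d, 3 * d, 5 * d}" ?A] by blast
  have ins: "insert m {d, 3 * d, 5 * d} = ?A" by blast
  have Y2: "(\<lambda>i. 2 * m + i * d) ` {1, 3, 5, 7, 11, 13, 15, 17} \<subseteq> ?X"
  proof
    fix r assume "r \<in> (\<lambda>i. 2 * m + i * d) ` {1, 3, 5, 7, 11, 13, 15, 17}"
    then obtain i where i: "i \<in> {1, 3, 5, 7, 11, 13, 15, 17}" "r = 2 * m + i * d" by blast
    then have "i * d \<in> omit_one_sums {d, 3 * d, 5 * d}" using Y by blast
    moreover have "m \<notin> {d, 3 * d, 5 * d}" using m d by simp
    ultimately show "r \<in> ?X" unfolding i(2) ins[symmetric] by (intro omit_one_sums_insert) auto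
  qed
  have mF: "m + 2 * \<Sum>F \<in> ?X" if "F \<subseteq> {d, 3 * d, 5 * d}" for F
    by (rule omit_one_sumsI[of m _ F]) (use that m d in auto)
  have d': "d \<noteq> 3 * d" "d \<noteq> 5 * d" "3 * d \<noteq> 5 * d" using d by simp_all
  have Z: "(\<lambda>i. m + i * d) ` {0, 2, 6, 8, 10, 12, 16, 18} \<subseteq> ?X"
    using mF[of "{}"] mF[of "{d}"] mF[of "{3 * d}"] mF[of "{d, 3 * d}"] mF[of "{5 * d}"]
      mF[of "{d, 5 * d}"] mF[of "{3 * d, 5 * d}"] mF[of "{d, 3 * d, 5 * d}"] d'
    by (simp add: algebra_simps)
  let ?I = "{1, 3, 5, 7, 11, 13, 15, 17} :: int set" and ?J = "{0, 2, 6, 8, 10, 12, 16, 18} :: int set"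
  have c: "card ((\<lambda>i. i * d) ` ?I) = 8" "card ((\<lambda>i. 2 * m + i * d) ` ?I) = 8"
    "card ((\<lambda>i. m + i * d) ` ?J) = 8"
    using d by (subst card_image; simp add: inj_on_def)+
  show *: "17 \<le> card ?X" if "m \<noteq> 7 * d"
  proof (cases "9 * d \<le> m")
    case True
    \<comment> \<open>The sum \<open>m + 8 * d\<close> falls strictly between the two blocks, except
      for \<open>m = 9 * d\<close>, when \<open>m\<close> fills the gap at \<open>9 * d\<close> in
      the lower block.\<close>
    let ?e = "if m = 9 * d then m else m + 8 * d"
    let ?S = "(\<lambda>i. i * d) ` ?I \<union> (\<lambda>i. 2 * m + i * d) ` ?I"
    have "?e \<in> ?X" using Z by auto
    then have "card (insert ?e ?S) \<le> card ?X" using Y1 Y2 fin by (intro card_mono) blast+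
    moreover have "?e \<notin> ?S" using True d by auto
    moreover have "card ?S = 16" using True d c by (subst card_Un_disjoint) auto
    ultimately show ?thesis by simp
  next
    case False
    let ?S = "(\<lambda>i. i * d) ` ?I \<union> (\<lambda>i. m + i * d) ` ?J"
    have "2 * m + 17 * d \<in> ?X" using Y2 by auto
    then have "card (insert (2 * m + 17 * d) ?S) \<le> card ?X" using Y1 Z fin by (intro card_mono) blast+
    moreover have "2 * m + 17 * d \<notin> ?S" using False d m by auto
    \<comment> \<open>A common value would make \<open>m\<close> an odd multiple of \<open>d\<close>
      strictly between \<open>5 * d\<close> and \<open>9 * d\<close>, hence
      \<open>7 * d\<close>.\<close>
    moreover have "card ?S = 16" using False d c m that by (subst card_Un_disjoint) auto
    ultimately show ?thesis by simp
  qed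
  show "16 \<le> card ?X"
  proof (cases "m = 7 * d")
    case True
    let ?I = "{1, 3, 5, 7, 9, 11, 13, 15, 17, 19, 21, 23, 25, 27, 29, 31} :: int set"
    have "(\<lambda>i. i * d) ` ?I \<subseteq> ?X" using Y1 Y2 Z unfolding True by auto
    then have "card ((\<lambda>i. i * d) ` ?I) \<le> card ?X" using fin by (intro card_mono)
    moreover have "card ((\<lambda>i. i * d) ` ?I) = card ?I" using d by (intro card_image) (auto simp: inj_on_def)
    ultimately show ?thesis by simp
  qed (use * in simp)
qed

section \<open>Odd multiples and their sums\<close>

lemma finite_odd_multiples: "finite (odd_multiples d n)"
  by (simp add: odd_multiples_def)

lemma odd_multiples_Suc: "odd_multiples d (Suc n) = insert (d * (2 * int n + 1)) (odd_multiples d n)"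
  by (auto simp: odd_multiples_def atLeastAtMostSuc_conv)

lemma odd_multiplesE:
  assumes "a \<in> odd_multiples d n"
  obtains i where "1 \<le> i" "i \<le> n" "a = d * (2 * int i - 1)"
  using assms by (auto simp: odd_multiples_def)

lemma odd_multiples_bounds:
  assumes "0 < d" "a \<in> odd_multiples d n"
  shows "d \<le> a" "a \<le> d * (2 * int n - 1)"
proof -
  obtain i where i: "1 \<le> i" "i \<le> n" "a = d * (2 * int i - 1)" using assms by (elim odd_multiplesE)
  have "d * 1 \<le> d * (2 * int i - 1)" using i assms by (intro mult_left_mono) auto
  then show "d \<le> a" using i by simp
  show "a \<le> d * (2 * int n - 1)" unfolding i(3) using i assms by (intro mult_left_mono) auto
qed

lemma card_odd_multiples: "0 < d \<Longrightarrow> card (odd_multiples d n) = n"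
  unfolding odd_multiples_def by (subst card_image) (auto simp: inj_on_def)

lemma sum_odd_multiples:
  assumes "0 < d"
  shows "\<Sum>(odd_multiples d n) = d * (int n)\<^sup>2"
proof (induction n)
  case (Suc n)
  have "d * (2 * int n + 1) \<notin> odd_multiples d n"
    using odd_multiples_bounds(2)[OF assms, of "d * (2 * int n + 1)" n] assms by auto
  then show ?case using Suc finite_odd_multiples[of d n]
    by (simp add: odd_multiples_Suc algebra_simps power2_eq_square)
qed (simp add: odd_multiples_def)

text \<open>Every sum is an odd multiple of \<open>d\<close> and at least \<open>d\<close>;
  reflection about \<open>d * (int n)\<^sup>2\<close> turns this into the upper bound.\<close>

lemma omit_one_sums_odd_multiples:
  assumes d: "0 < d"
  shows "omit_one_sums (odd_multiples d n) \<subseteq> odd_multiples d (n\<^sup>2)"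
proof
  let ?A = "odd_multiples d n"
  fix r assume r: "r \<in> omit_one_sums ?A"
  have pos: "0 < a" if "a \<in> ?A" for a using odd_multiples_bounds[OF d that] d by linarith
  obtain a F where aF: "a \<in> ?A" "F \<subseteq> ?A" "r = a + 2 * \<Sum>F" using r by (auto simp: omit_one_sums_def)
  obtain i where i: "a = d * (2 * int i - 1)" using aF by (auto elim: odd_multiplesE)
  have "d dvd \<Sum>F" using aF(2) by (intro dvd_sum) (auto elim!: odd_multiplesE)
  then obtain s where s: "\<Sum>F = d * s" by (auto simp: dvd_def)
  define q where "q = int i + s"
  have rq: "r = d * (2 * q - 1)" using aF i s by (simp add: q_def algebra_simps)
  have "Min ?A \<in> ?A" using aF finite_odd_multiples by (intro Min_in) auto
  then have "d \<le> Min ?A" using odd_multiples_bounds(1)[OF d] by auto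
  then have "d \<le> r" "d \<le> 2 * (d * (int n)\<^sup>2) - r"
    using omit_one_sums_ge[OF finite_odd_multiples pos r]
      omit_one_sums_ge[OF finite_odd_multiples pos omit_one_sums_reflect[OF finite_odd_multiples r]]
    by (auto simp: sum_odd_multiples[OF d])
  then have "d * 1 \<le> d * (2 * q - 1)" "d * (2 * q) \<le> d * (2 * (int n)\<^sup>2)"
    unfolding rq by (auto simp: algebra_simps)
  then have "1 \<le> q" "q \<le> (int n)\<^sup>2" using d by auto
  then have "1 \<le> nat q" "nat q \<le> n\<^sup>2" "int (nat q) = q" by (auto simp: nat_le_iff)
  then show "r \<in> odd_multiples d (n\<^sup>2)" unfolding odd_multiples_def rq by force
qed

section \<open>Four elements, and the induction from there\<close>

lemma card_3_sorted:
  fixes S :: "int set"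
  assumes "card S = 3"
  obtains a b c where "a < b" "b < c" "S = {a, b, c}"
proof -
  obtain x y z where S: "S = {x, y, z}" and ne: "x \<noteq> y" "y \<noteq> z" "x \<noteq> z"
    using assms by (auto simp: card_3_iff)
  consider "x < y" "y < z" | "x < z" "z < y" | "y < x" "x < z" | "y < z" "z < x" | "z < x" "x < y" | "z < y" "y < x"
    using ne by linarith
  then show thesis using that S by cases (metis insert_commute)+
qed

text \<open>Unless the three smallest elements are in the ratio 1:3:5, they have at least 10 sums,
  and the largest element brings this to at least 17. The remaining case is the explicit
  count.\<close>

lemma card_omit_one_sums_four:
  assumes fin: "finite A" and pos: "\<And>a. a \<in> A \<Longrightarrow> 0 < a" and n: "card A = 4"
  shows "16 \<le> card (omit_one_sums A) \<and>
    (card (omit_one_sums A) = 16 \<longrightarrow> (\<exists>d>0. A = odd_multiples d 4))"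
proof -
  define m where "m = Max A"
  have m: "m \<in> A" using fin n by (auto simp: m_def intro!: Max_in)
  have "card (A - {m}) = 3" using m n fin by simp
  then obtain a b c where abc: "a < b" "b < c" "A - {m} = {a, b, c}" by (rule card_3_sorted)
  have A: "A = {a, b, c, m}" using abc m by blast
  have c: "0 < a" "c < m" using pos[of a] A Max_ge[OF fin, of c] abc(3) unfolding m_def[symmetric]
    by (simp, metis A insert_iff Diff_iff order_le_imp_less_or_eq singletonI)
  show ?thesis
  proof (cases "b = 3 * a \<and> c = 5 * a")
    case True
    then have A': "A = {a, 3 * a, 5 * a, m}" using A by simp
    show ?thesis
    proof (cases "m = 7 * a")
      case True
      have "odd_multiples a 4 = {a, 3 * a, 5 * a, m}"
        unfolding True by (auto simp: odd_multiples_def numeral_eq_Suc atLeastAtMostSuc_conv)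
      then show ?thesis using card_omit_one_sums_1_3_5(1)[of a m] A' True c by auto
    next
      case False
      then show ?thesis using card_omit_one_sums_1_3_5(2)[of a m] A' \<open>b = 3 * a \<and> c = 5 * a\<close> c by auto
    qed
  next
    case False
    then have "10 \<le> card (omit_one_sums (A - {m}))"
      using card_omit_one_sums_three[of a b c] abc c by simp
    then show ?thesis using card_omit_one_sums_step[OF fin pos] n by (simp add: m_def)
  qed
qed

text \<open>To the \<open>n\<^sup>2\<close> old sums another \<open>2 * n + 2\<close> are added. If
  \<open>m\<close> is beyond the next odd multiple, the top \<open>2 * n + 2\<close> translates by
  \<open>2 * m\<close> clear the old sums. If \<open>m\<close> is before it, the top
  \<open>2 * n\<close> do, and \<open>m\<close> and \<open>m + 2 * d\<close> lie off the odd
  multiples of \<open>d\<close> and below these translates.\<close>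

lemma card_omit_one_sums_extend:
  assumes d: "0 < d" and n: "4 \<le> n" and m: "d * (2 * int n - 1) < m" "m \<noteq> d * (2 * int n + 1)"
    and X: "omit_one_sums (odd_multiples d n) = odd_multiples d (n\<^sup>2)"
  shows "(n + 1)\<^sup>2 < card (omit_one_sums (insert m (odd_multiples d n)))"
proof -
  let ?A = "odd_multiples d n"
  let ?X = "omit_one_sums (insert m ?A)"
  let ?f = "\<lambda>i. 2 * m + d * (2 * int i - 1)"
  have finX: "finite ?X" by (simp add: finite_omit_one_sums finite_odd_multiples)
  have mA: "m \<notin> ?A" using odd_multiples_bounds(2)[OF d] m by force
  have dA: "d \<in> ?A" using n unfolding odd_multiples_def by (intro image_eqI[of _ _ 1]) auto
  have low: "odd_multiples d (n\<^sup>2) \<subseteq> ?X" using X omit_one_sums_mono[of ?A "insert m ?A"] by blast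
  have high: "?f i \<in> ?X" if "1 \<le> i" "i \<le> n\<^sup>2" for i
  proof -
    have "d * (2 * int i - 1) \<in> omit_one_sums ?A" using X that by (auto simp: odd_multiples_def)
    then show ?thesis by (rule omit_one_sums_insert[OF finite_odd_multiples mA])
  qed
  have inj: "inj_on ?f I" for I using d by (auto simp: inj_on_def)
  have n2: "4 * n \<le> n\<^sup>2" using n by (simp add: power2_eq_square)
  show ?thesis
  proof (cases "d * (2 * int n + 1) < m")
    case True
    let ?U = "?f ` {n\<^sup>2 - (2 * n + 1)..n\<^sup>2}"
    have "odd_multiples d (n\<^sup>2) \<inter> ?U = {}"
    proof (rule equals0I)
      fix r assume "r \<in> odd_multiples d (n\<^sup>2) \<inter> ?U"
      then obtain i where "i \<in> {n\<^sup>2 - (2 * n + 1)..n\<^sup>2}" "r = ?f i" "r \<in> odd_multiples d (n\<^sup>2)" by blast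
      then have r: "r \<le> d * (2 * int (n\<^sup>2) - 1)" "r = ?f i" "n\<^sup>2 - (2 * n + 1) \<le> i"
        using odd_multiples_bounds(2)[OF d, of r "n\<^sup>2"] by simp_all
      have "d * (2 * (2 * int n + 1)) + d * (2 * int i - 1) < d * (2 * int (n\<^sup>2) - 1)"
        using r True by (simp add: algebra_simps)
      then have "d * (2 * (2 * int n + 1) + (2 * int i - 1)) < d * (2 * int (n\<^sup>2) - 1)"
        by (simp only: distrib_left)
      then have "2 * (2 * int n + 1) + (2 * int i - 1) < 2 * int (n\<^sup>2) - 1" using d by simp
      moreover have "int (n\<^sup>2) \<le> int (i + (2 * n + 1))" using r(3) by (subst of_nat_le_iff) simp
      ultimately show False by simp
    qed
    moreover have "?U \<subseteq> ?X" using high n n2 by auto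
    ultimately have "card (odd_multiples d (n\<^sup>2)) + card ?U \<le> card ?X"
      using low finX by (subst card_Un_disjoint[symmetric]) (auto intro!: card_mono simp: finite_odd_multiples)
    moreover have "card ?U = 2 * n + 2" using n n2 by (subst card_image[OF inj]) auto
    ultimately show ?thesis by (simp add: card_odd_multiples[OF d] power2_eq_square)
  next
    case False
    then have m': "m < d * (2 * int n + 1)" using m by simp
    let ?U = "?f ` {n\<^sup>2 - (2 * n - 1)..n\<^sup>2}"
    have dm: "d < m" "0 < m"
    proof -
      have "d * 1 \<le> d * (2 * int n - 1)" using d n by (intro mult_left_mono) auto
      then show "d < m" using m by simp
      then show "0 < m" using d by simp
    qed
    have U: "2 * m + d \<le> r" if "r \<in> ?U" for r
    proof -
      obtain i where "i \<in> {n\<^sup>2 - (2 * n - 1)..n\<^sup>2}" "r = ?f i" using \<open>r \<in> ?U\<close> by blast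
      moreover have "d * 1 \<le> d * (2 * int i - 1)" using calculation(1) n n2 d by (intro mult_left_mono) auto
      ultimately show ?thesis by simp
    qed
    have disj: "odd_multiples d (n\<^sup>2) \<inter> ?U = {}"
    proof (rule equals0I)
      fix r assume "r \<in> odd_multiples d (n\<^sup>2) \<inter> ?U"
      then obtain i where "i \<in> {n\<^sup>2 - (2 * n - 1)..n\<^sup>2}" "r = ?f i" "r \<in> odd_multiples d (n\<^sup>2)" by blast
      then have r: "r \<le> d * (2 * int (n\<^sup>2) - 1)" "r = ?f i" "n\<^sup>2 - (2 * n - 1) \<le> i"
        using odd_multiples_bounds(2)[OF d, of r "n\<^sup>2"] by simp_all
      have "d * (2 * (2 * int n - 1)) + d * (2 * int i - 1) < d * (2 * int (n\<^sup>2) - 1)"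
        using r m by (simp add: algebra_simps)
      then have "d * (2 * (2 * int n - 1) + (2 * int i - 1)) < d * (2 * int (n\<^sup>2) - 1)"
        by (simp only: distrib_left)
      then have "2 * (2 * int n - 1) + (2 * int i - 1) < 2 * int (n\<^sup>2) - 1" using d by simp
      moreover have "int (n\<^sup>2 + 1) \<le> int (i + 2 * n)" using r(3) n by (subst of_nat_le_iff) simp
      ultimately show False by simp
    qed
    have nod: "m + 2 * d * j \<noteq> d * (2 * int i - 1)" for i j
    proof
      assume "m + 2 * d * j = d * (2 * int i - 1)"
      then have "m = d * (2 * (int i - j) - 1)" by (simp add: algebra_simps)
      then have "2 * int n - 1 < 2 * (int i - j) - 1" "2 * (int i - j) - 1 < 2 * int n + 1"
        using m(1) m' d by simp_all
      then show False by presburger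
    qed
    note disj
    moreover have "{m, m + 2 * d} \<inter> (odd_multiples d (n\<^sup>2) \<union> ?U) = {}"
    proof -
      have "m \<notin> odd_multiples d (n\<^sup>2)" "m + 2 * d \<notin> odd_multiples d (n\<^sup>2)"
        using nod[of 0] nod[of 1] by (auto simp: odd_multiples_def)
      moreover have "m \<notin> ?U" "m + 2 * d \<notin> ?U" using U[of m] U[of "m + 2 * d"] dm d by linarith+
      ultimately show ?thesis by blast
    qed
    moreover have "?U \<subseteq> ?X" using high n n2 by auto
    moreover have "{m, m + 2 * d} \<subseteq> ?X"
      using omit_one_sumsI[of m "insert m ?A" "{}"] omit_one_sumsI[of m "insert m ?A" "{d}"] dA dm by auto
    ultimately have "card {m, m + 2 * d} + (card (odd_multiples d (n\<^sup>2)) + card ?U) \<le> card ?X"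
      using low finX
      by (subst card_Un_disjoint[symmetric], simp_all add: finite_odd_multiples, subst card_Un_disjoint[symmetric])
        (auto intro!: card_mono simp: finite_odd_multiples)
    moreover have "card ?U = 2 * n" using n n2 by (subst card_image[OF inj]) auto
    moreover have "card {m, m + 2 * d} = 2" using d by simp
    ultimately show ?thesis by (simp add: card_odd_multiples[OF d] power2_eq_square)
  qed
qed

text \<open>In the equality case the set without its maximum is extremal too, so by induction it
  consists of odd multiples; by cardinality its sums fill
  \<open>odd_multiples d (n\<^sup>2)\<close>. Then \<open>card_omit_one_sums_extend\<close> leaves
  one value for the maximum.\<close>

lemma card_omit_one_sums_ge:
  assumes "4 \<le> n" "finite A" "\<And>a. a \<in> A \<Longrightarrow> 0 < a" "card A = n"
  shows "n\<^sup>2 \<le> card (omit_one_sums A) \<and>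
    (card (omit_one_sums A) = n\<^sup>2 \<longrightarrow> (\<exists>d>0. A = odd_multiples d n))"
  using assms
proof (induction n arbitrary: A rule: dec_induct)
  case base
  then show ?case using card_omit_one_sums_four[of A] by simp
next
  case (step n)
  define m where "m = Max A"
  have "A \<noteq> {}" using step.prems by auto
  then have m: "m \<in> A" using step.prems by (simp add: m_def)
  have c: "card (A - {m}) = n" using m step by simp
  have IH: "n\<^sup>2 \<le> card (omit_one_sums (A - {m}))"
    "card (omit_one_sums (A - {m})) = n\<^sup>2 \<Longrightarrow> \<exists>d>0. A - {m} = odd_multiples d n"
    using step.IH[of "A - {m}"] c step.prems by auto
  have st: "card (omit_one_sums (A - {m})) + 2 * Suc n - 1 \<le> card (omit_one_sums A)"
    using card_omit_one_sums_step[of A] step by (simp add: m_def)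
  have sq: "(Suc n)\<^sup>2 = n\<^sup>2 + 2 * n + 1" by (simp add: power2_eq_square)
  have "\<exists>d>0. A = odd_multiples d (Suc n)" if eq: "card (omit_one_sums A) = (Suc n)\<^sup>2"
  proof -
    have c2: "card (omit_one_sums (A - {m})) = n\<^sup>2" using st sq eq IH(1) by simp
    then obtain d where d: "0 < d" "A - {m} = odd_multiples d n" using IH(2) by blast
    have A: "A = insert m (odd_multiples d n)" using d m by blast
    have X: "omit_one_sums (odd_multiples d n) = odd_multiples d (n\<^sup>2)"
      using c2 d omit_one_sums_odd_multiples[OF d(1), of n]
      by (intro card_subset_eq) (auto simp: card_odd_multiples finite_odd_multiples)
    have "d * (2 * int n - 1) \<in> A - {m}" unfolding d(2) odd_multiples_def using step.hyps by auto
    then have "d * (2 * int n - 1) < m" using step.prems(1) by (auto simp: m_def less_le)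
    then have "m = d * (2 * int n + 1)"
      using card_omit_one_sums_extend[OF d(1) _ _ _ X, of m] A eq step.hyps sq by (fastforce simp: power2_eq_square)
    then show ?thesis using A d by (metis odd_multiples_Suc)
  qed
  then show ?case using st IH(1) sq by auto
qed

subsection \<open>Restricted signed sumsets\<close>

text \<open>\<open>P\<close> and \<open>Q\<close> are the sets where the coefficient is 1 and
  -1.\<close>

lemma restricted_signed_sumset_eq:
  assumes fin: "finite A"
  shows "restricted_signed_sumset h A =
    {\<Sum>P - \<Sum>Q | P Q. P \<subseteq> A \<and> Q \<subseteq> A \<and> P \<inter> Q = {} \<and> card P + card Q = h}" (is "_ = ?R")
proof -
  have val: "(\<Sum>a\<in>A. l a * a) = \<Sum>{a\<in>A. l a = 1} - \<Sum>{a\<in>A. l a = -1}"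
    and len: "(\<Sum>a\<in>A. \<bar>l a\<bar>) = int (card {a\<in>A. l a = 1} + card {a\<in>A. l a = -1})"
    if "\<forall>a\<in>A. l a \<in> {-1, 0, 1}" for l :: "int \<Rightarrow> int"
  proof -
    have "(\<Sum>a\<in>A. l a * a) = (\<Sum>a\<in>A. (if l a = 1 then a else 0) - (if l a = -1 then a else 0))"
      using that by (intro sum.cong) auto
    then show "(\<Sum>a\<in>A. l a * a) = \<Sum>{a\<in>A. l a = 1} - \<Sum>{a\<in>A. l a = -1}"
      using fin by (simp add: sum_subtractf sum.inter_filter)
    have "(\<Sum>a\<in>A. \<bar>l a\<bar>) = (\<Sum>a\<in>A. (if l a = 1 then 1 else 0) + (if l a = -1 then 1 else 0))"
      using that by (intro sum.cong) auto
    then show "(\<Sum>a\<in>A. \<bar>l a\<bar>) = int (card {a\<in>A. l a = 1} + card {a\<in>A. l a = -1})"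
      using fin by (simp add: sum.distrib flip: sum.inter_filter)
  qed
  show ?thesis
  proof (intro equalityI subsetI)
    fix r assume "r \<in> restricted_signed_sumset h A"
    then obtain l where l: "\<forall>a\<in>A. l a \<in> {-1, 0, 1}" "(\<Sum>a\<in>A. \<bar>l a\<bar>) = int h" "r = (\<Sum>a\<in>A. l a * a)"
      by (auto simp: restricted_signed_sumset_def)
    have "r = \<Sum>{a\<in>A. l a = 1} - \<Sum>{a\<in>A. l a = -1}" "card {a\<in>A. l a = 1} + card {a\<in>A. l a = -1} = h"
      using val[OF l(1)] len[OF l(1)] l(2,3) by simp_all
    moreover have "{a\<in>A. l a = 1} \<inter> {a\<in>A. l a = -1} = {}" by auto
    ultimately show "r \<in> ?R" by blast
  next
    fix r assume "r \<in> ?R"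
    then obtain P Q where PQ: "r = \<Sum>P - \<Sum>Q" "P \<subseteq> A" "Q \<subseteq> A" "P \<inter> Q = {}" "card P + card Q = h"
      by blast
    define l where "l = (\<lambda>a. if a \<in> P then 1 else if a \<in> Q then -1 else 0 :: int)"
    have l: "\<forall>a\<in>A. l a \<in> {-1, 0, 1}" by (simp add: l_def)
    have "{a\<in>A. l a = 1} = P" "{a\<in>A. l a = -1} = Q"
      using PQ by (auto simp: l_def split: if_splits)
    then have "r = (\<Sum>a\<in>A. l a * a)" "(\<Sum>a\<in>A. \<bar>l a\<bar>) = int h" using val[OF l] len[OF l] PQ by simp_all
    then show "r \<in> restricted_signed_sumset h A" unfolding restricted_signed_sumset_def using l by blast
  qed
qed

lemma restricted_signed_sumsetI:
  assumes "finite A" "P \<subseteq> A" "card P = h"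
  shows "\<Sum>P \<in> restricted_signed_sumset h A"
  unfolding restricted_signed_sumset_eq[OF assms(1)] using assms(2,3)
  by (intro CollectI exI[of _ P] exI[of _ "{}"]) simp

lemma finite_restricted_signed_sumset: "finite A \<Longrightarrow> finite (restricted_signed_sumset h A)"
  by (rule finite_subset[of _ "(\<lambda>(P, Q). \<Sum>P - \<Sum>Q) ` (Pow A \<times> Pow A)"])
    (auto simp: restricted_signed_sumset_eq)

lemma restricted_signed_sumset_uminus:
  assumes "finite A" "r \<in> restricted_signed_sumset h A"
  shows "- r \<in> restricted_signed_sumset h A"
proof -
  obtain P Q where PQ: "r = \<Sum>P - \<Sum>Q" "P \<subseteq> A" "Q \<subseteq> A" "P \<inter> Q = {}" "card P + card Q = h"
    using assms by (auto simp: restricted_signed_sumset_eq)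
  then have "- r = \<Sum>Q - \<Sum>P" "Q \<inter> P = {}" "card Q + card P = h" by auto
  then show ?thesis unfolding restricted_signed_sumset_eq[OF assms(1)] using PQ by blast
qed

lemma restricted_signed_sumset_mono:
  assumes "finite B" "A \<subseteq> B"
  shows "restricted_signed_sumset h A \<subseteq> restricted_signed_sumset h B"
  using assms finite_subset[OF assms(2,1)] by (fastforce simp: restricted_signed_sumset_eq)

section \<open>Absolute values, and sums omitting one element\<close>

lemma inj_on_abs:
  fixes A :: "int set"
  assumes "A \<inter> uminus ` A = {}"
  shows "inj_on abs A"
proof (rule inj_onI)
  fix x y :: int assume "x \<in> A" "y \<in> A" "\<bar>x\<bar> = \<bar>y\<bar>"
  then show "x = y" using assms by (auto simp: abs_eq_iff)
qed

text \<open>The sign of each \<open>a\<close> is absorbed into its coefficient; no \<open>a\<close>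
  is zero and \<open>abs\<close> is injective on \<open>A\<close>. This inclusion suffices, because
  the bound for \<open>A_abs A\<close> is a lower bound.\<close>

lemma restricted_signed_sumset_A_abs:
  assumes "finite A" "A \<inter> uminus ` A = {}"
  shows "restricted_signed_sumset h (A_abs A) \<subseteq> restricted_signed_sumset h A"
proof
  have A: "A_abs A = abs ` A" by (auto simp: A_abs_def)
  note inj = inj_on_abs[OF assms(2)]
  have nz: "a \<noteq> 0" if "a \<in> A" for a using that assms(2) by force
  fix r assume "r \<in> restricted_signed_sumset h (A_abs A)"
  then obtain l where l: "\<forall>a\<in>abs ` A. l a \<in> {-1, 0, 1}" "(\<Sum>a\<in>abs ` A. \<bar>l a\<bar>) = int h"
      "r = (\<Sum>a\<in>abs ` A. l a * a)"
    unfolding A restricted_signed_sumset_def by blast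
  have "r = (\<Sum>a\<in>A. (l \<bar>a\<bar> * sgn a) * a)"
    unfolding l(3) sum.reindex[OF inj] by (intro sum.cong) (auto simp: abs_sgn mult_ac)
  moreover have "(\<Sum>a\<in>A. \<bar>l \<bar>a\<bar> * sgn a\<bar>) = int h"
    unfolding l(2)[symmetric] sum.reindex[OF inj] using nz by (intro sum.cong) (auto simp: abs_mult)
  moreover have "\<forall>a\<in>A. l \<bar>a\<bar> * sgn a \<in> {-1, 0, 1}" using l(1) by (auto simp: sgn_if)
  ultimately show "r \<in> restricted_signed_sumset h A" unfolding restricted_signed_sumset_def
    by (intro CollectI exI[of _ "\<lambda>a. l \<bar>a\<bar> * sgn a"]) blast
qed

text \<open>Exactly one element \<open>a\<close> has coefficient 0, and adding
  \<open>\<Sum>A\<close> turns \<open>\<Sum>P - \<Sum>Q\<close> into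
  \<open>a + 2 * \<Sum>P\<close>.\<close>

lemma card_restricted_signed_sumset_omit_one:
  assumes fin: "finite A" and card: "card A = Suc h"
  shows "card (restricted_signed_sumset h A) = card (omit_one_sums A)"
proof -
  have "restricted_signed_sumset h A = (\<lambda>x. x - \<Sum>A) ` omit_one_sums A"
  proof (intro equalityI subsetI)
    fix r assume "r \<in> restricted_signed_sumset h A"
    then obtain P Q where PQ: "r = \<Sum>P - \<Sum>Q" "P \<subseteq> A" "Q \<subseteq> A" "P \<inter> Q = {}" "card P + card Q = h"
      using fin by (auto simp: restricted_signed_sumset_eq)
    have finPQ: "finite P" "finite Q" using PQ fin by (auto intro: finite_subset)
    have "card (A - (P \<union> Q)) = 1"
      using PQ card finPQ by (simp add: card_Diff_subset card_Un_disjoint)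
    then obtain a where a: "A - (P \<union> Q) = {a}" by (auto simp: card_1_singleton_iff)
    then have A: "A = insert a (P \<union> Q)" "a \<notin> P" "a \<notin> Q" using PQ by blast+
    then have "\<Sum>A = a + \<Sum>P + \<Sum>Q" using finPQ PQ by (simp add: sum.union_disjoint)
    then have "r = (a + 2 * \<Sum>P) - \<Sum>A" using PQ by simp
    moreover have "a + 2 * \<Sum>P \<in> omit_one_sums A" using A by (intro omit_one_sumsI[of a _ P]) auto
    ultimately show "r \<in> (\<lambda>x. x - \<Sum>A) ` omit_one_sums A" by blast
  next
    fix r assume "r \<in> (\<lambda>x. x - \<Sum>A) ` omit_one_sums A"
    then obtain a F where aF: "a \<in> A" "F \<subseteq> A - {a}" "r = a + 2 * \<Sum>F - \<Sum>A"
      by (auto simp: omit_one_sums_def)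
    have finF: "finite F" using aF fin finite_subset by blast
    have "\<Sum>(A - {a} - F) = \<Sum>A - a - \<Sum>F" using aF fin by (simp add: sum_diff sum_diff1 finF)
    moreover have "card (A - {a} - F) = h - card F"
      using aF fin card finF by (subst card_Diff_subset) auto
    moreover have "card F \<le> h" using card_mono[OF _ aF(2)] fin aF card by simp
    ultimately have "r = \<Sum>F - \<Sum>(A - {a} - F)" "card F + card (A - {a} - F) = h" using aF by simp_all
    then show "r \<in> restricted_signed_sumset h A"
      unfolding restricted_signed_sumset_eq[OF fin] using aF by blast
  qed
  then show ?thesis by (simp add: card_image inj_on_def)
qed

section \<open>Sums compared with the largest elements\<close>

lemma exists_top_subset:
  fixes A :: "int set"
  assumes "finite A" "h \<le> card A"
  shows "\<exists>H\<subseteq>A. card H = h \<and> (\<forall>x\<in>H. \<forall>y\<in>A - H. y < x)"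
  using assms(2)
proof (induction h)
  case 0
  show ?case by (rule exI[of _ "{}"]) simp
next
  case (Suc h)
  then obtain H where H: "H \<subseteq> A" "card H = h" "\<forall>x\<in>H. \<forall>y\<in>A - H. y < x" by auto
  have finH: "finite H" using H assms by (auto intro: finite_subset)
  have "A - H \<noteq> {}" using H Suc.prems finH card_mono[OF finH, of A] by auto
  then have M: "Max (A - H) \<in> A - H" using assms by (intro Max_in) auto
  have "y < Max (A - H)" if "y \<in> A - insert (Max (A - H)) H" for y
    using that assms by (auto simp: less_le)
  then show ?case using H M finH by (intro exI[of _ "insert (Max (A - H)) H"]) auto
qed

text \<open>A bijection from \<open>G - H\<close> to \<open>H - G\<close> replaces each element by a
  larger one.\<close>

lemma sum_le_top_subset:
  fixes A :: "int set"
  assumes "finite A" "H \<subseteq> A" "\<forall>x\<in>H. \<forall>y\<in>A - H. y < x" "G \<subseteq> A" "card G = card H"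
  shows "\<Sum>G \<le> \<Sum>H"
proof -
  have fin: "finite G" "finite H" using assms by (auto intro: finite_subset)
  have "card (G - H) = card (H - G)"
    using assms(5) fin by (metis card_Diff_subset_Int finite_Int inf_commute)
  then obtain f where f: "bij_betw f (G - H) (H - G)" using fin finite_same_card_bij by blast
  have "\<Sum>(G - H) \<le> sum f (G - H)"
  proof (rule sum_mono)
    fix x assume x: "x \<in> G - H"
    then have "f x \<in> H - G" using f by (auto simp: bij_betw_def)
    then show "x \<le> f x" using x assms(3,4) by (meson DiffD1 DiffD2 DiffI less_imp_le subsetD)
  qed
  also have "\<dots> = \<Sum>(H - G)" using sum.reindex_bij_betw[OF f, of "\<lambda>x. x"] by simp
  finally show ?thesis
    using fin sum.Int_Diff[of G "\<lambda>x. x" H] sum.Int_Diff[of H "\<lambda>x. x" G] by (simp add: Int_commute)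
qed

lemma restricted_signed_sumset_bound:
  assumes fin: "finite A" and pos: "\<And>a. a \<in> A \<Longrightarrow> 0 < a"
    and H: "H \<subseteq> A" "\<forall>x\<in>H. \<forall>y\<in>A - H. y < x" and r: "r \<in> restricted_signed_sumset (card H) A"
  shows "\<bar>r\<bar> \<le> \<Sum>H"
proof -
  obtain P Q where PQ: "r = \<Sum>P - \<Sum>Q" "P \<subseteq> A" "Q \<subseteq> A" "P \<inter> Q = {}" "card P + card Q = card H"
    using r fin by (auto simp: restricted_signed_sumset_eq)
  have finPQ: "finite P" "finite Q" using PQ fin by (auto intro: finite_subset)
  have "0 \<le> \<Sum>P" "0 \<le> \<Sum>Q" using PQ pos by (auto intro!: sum_nonneg dest!: less_imp_le)
  then have "\<bar>r\<bar> \<le> \<Sum>(P \<union> Q)" using PQ finPQ by (simp add: sum.union_disjoint)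
  also have "\<dots> \<le> \<Sum>H"
    using PQ finPQ by (intro sum_le_top_subset[OF fin H]) (auto simp: card_Un_disjoint)
  finally show ?thesis .
qed

text \<open>\<open>W\<close> consists of the sums of \<open>insert m H\<close> with one
  \<open>j\<close> in \<open>H\<close> omitted. They exceed \<open>\<Sum>H\<close>, which bounds the
  old sums in absolute value, so the old sums, \<open>W\<close> and its negatives are
  disjoint.\<close>

lemma restricted_signed_sumset_new:
  assumes fin: "finite A" and pos: "\<And>a. a \<in> A \<Longrightarrow> 0 < a" and m: "\<And>a. a \<in> A \<Longrightarrow> a < m"
    and H: "H \<subseteq> A" "\<forall>x\<in>H. \<forall>y\<in>A - H. y < x"
  defines "W \<equiv> (\<lambda>j. \<Sum>H + m - j) ` H"
  shows "restricted_signed_sumset (card H) A \<union> W \<union> uminus ` W \<subseteq> restricted_signed_sumset (card H) (insert m A)"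
    and "card (restricted_signed_sumset (card H) A \<union> W \<union> uminus ` W) = card (restricted_signed_sumset (card H) A) + 2 * card H"
proof -
  have finH: "finite H" using H fin by (auto intro: finite_subset)
  have sH: "0 \<le> \<Sum>H" using H pos by (auto intro!: sum_nonneg dest!: less_imp_le)
  have mH: "m \<notin> H" using m H by blast
  have W1: "W \<subseteq> restricted_signed_sumset (card H) (insert m A)"
  proof
    fix r assume "r \<in> W"
    then obtain j where j: "j \<in> H" "r = \<Sum>H + m - j" by (auto simp: W_def)
    then have "r = \<Sum>(insert m (H - {j}))" using finH mH by (simp add: sum_diff1)
    moreover have "card (insert m (H - {j})) = card H" using finH mH j card_Suc_Diff1[of H j] by (simp del: card_Diff_insert)
    ultimately show "r \<in> restricted_signed_sumset (card H) (insert m A)"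
      using restricted_signed_sumsetI[of "insert m A" "insert m (H - {j})" "card H"] fin H by auto
  qed
  then show "restricted_signed_sumset (card H) A \<union> W \<union> uminus ` W \<subseteq> restricted_signed_sumset (card H) (insert m A)"
    using restricted_signed_sumset_mono[of "insert m A" A "card H"] fin
      restricted_signed_sumset_uminus[of "insert m A" _ "card H"] by auto
  have Wgt: "\<Sum>H < r" if "r \<in> W" for r using that m H by (force simp: W_def)
  have bd: "\<bar>r\<bar> \<le> \<Sum>H" if "r \<in> restricted_signed_sumset (card H) A" for r
    using restricted_signed_sumset_bound[OF fin pos H that] .
  have "restricted_signed_sumset (card H) A \<inter> W = {}" using Wgt bd by force
  moreover have "(restricted_signed_sumset (card H) A \<union> W) \<inter> uminus ` W = {}"
  proof (rule equals0I)
    fix r assume "r \<in> (restricted_signed_sumset (card H) A \<union> W) \<inter> uminus ` W"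
    then have "- \<Sum>H \<le> r" "- r \<in> W" using Wgt[of r] bd[of r] sH by auto
    then show False using Wgt[of "- r"] by simp
  qed
  moreover have "card W = card H" unfolding W_def by (rule card_image) (simp add: inj_on_def)
  moreover have "card (uminus ` W) = card W" by (rule card_image) simp
  moreover have "finite W" using finH by (simp add: W_def)
  ultimately show "card (restricted_signed_sumset (card H) A \<union> W \<union> uminus ` W) = card (restricted_signed_sumset (card H) A) + 2 * card H"
    using finite_restricted_signed_sumset[OF fin, of "card H"] by (simp add: card_Un_disjoint)
qed

section \<open>Rigidity of the extremal sets\<close>

lemma dvd_restricted_signed_sumset_odd_multiples:
  assumes "r \<in> restricted_signed_sumset h (odd_multiples d n)"
  shows "2 * d dvd r - d * int h"
proof -
  obtain P Q where PQ: "r = \<Sum>P - \<Sum>Q" "P \<subseteq> odd_multiples d n" "Q \<subseteq> odd_multiples d n" "card P + card Q = h"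
    using assms by (auto simp: restricted_signed_sumset_eq finite_odd_multiples)
  \<comment> \<open>Each element is congruent to \<open>d\<close> modulo \<open>2 * d\<close>, and
    so is its negative; only the number of summands matters.\<close>
  have *: "2 * d dvd \<Sum>P - d * int (card P)" if "P \<subseteq> odd_multiples d n" for P
  proof -
    have "2 * d dvd a - d" if "a \<in> P" for a
    proof -
      obtain i where "a = d * (2 * int i - 1)" using \<open>a \<in> P\<close> \<open>P \<subseteq> _\<close> by (auto elim: odd_multiplesE)
      then have "a - d = 2 * d * (int i - 1)" by (simp add: algebra_simps)
      then show ?thesis by simp
    qed
    then have "2 * d dvd (\<Sum>a\<in>P. a - d)" by (intro dvd_sum) auto
    then show ?thesis by (simp add: sum_subtractf mult.commute)
  qed
  have "r - d * int h = (\<Sum>P - d * int (card P)) - (\<Sum>Q - d * int (card Q)) - 2 * d * int (card Q)"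
    using PQ(1,4) by (auto simp: algebra_simps)
  moreover have "2 * d dvd \<dots>" by (rule dvd_diff[OF dvd_diff[OF *[OF PQ(2)] *[OF PQ(3)]]]) simp
  ultimately show ?thesis by simp
qed

text \<open>One sum \<open>v\<close> is found beyond those of
  \<open>restricted_signed_sumset_new\<close>. With \<open>H\<close> the \<open>h\<close> largest
  elements, \<open>t\<close> the largest and \<open>b\<close> the largest outside \<open>H\<close>,
  it is the sum of \<open>H\<close> after \<open>t\<close> is replaced by \<open>m\<close> and
  \<open>b + 2 * d\<close> by \<open>b\<close>.\<close>

lemma card_restricted_signed_sumset_extend:
  assumes d: "0 < d" and h: "2 \<le> h" "h < n"
    and m: "d * (2 * int n - 1) < m" "m \<noteq> d * (2 * int n + 1)"
  shows "card (restricted_signed_sumset h (odd_multiples d n)) + 2 * h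
    < card (restricted_signed_sumset h (insert m (odd_multiples d n)))"
proof -
  let ?A = "odd_multiples d n"
  define t where "t = d * (2 * int n - 1)"
  have fin: "finite ?A" by (rule finite_odd_multiples)
  have pos: "0 < a" and mA: "a < m" and tA: "a \<le> t" if "a \<in> ?A" for a
    using odd_multiples_bounds[OF d that] d m by (auto simp: t_def)
  obtain H where H: "H \<subseteq> ?A" "card H = h" "\<forall>x\<in>H. \<forall>y\<in>?A - H. y < x"
    using exists_top_subset[OF fin, of h] h card_odd_multiples[OF d, of n] by auto
  have finH: "finite H" using H fin by (auto intro: finite_subset)
  have "H \<noteq> {}" using H h by auto
  have "?A - H \<noteq> {}" using H h card_mono[OF finH, of ?A] card_odd_multiples[OF d, of n] by auto
  define b where "b = Max (?A - H)"
  have b: "b \<in> ?A" "b \<notin> H" using Max_in[of "?A - H"] fin \<open>?A - H \<noteq> {}\<close> by (auto simp: b_def)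
  have bmax: "a \<le> b" if "a \<in> ?A - H" for a using that fin by (simp add: b_def)
  have tin: "t \<in> ?A" using h unfolding odd_multiples_def t_def by auto
  obtain x where x: "x \<in> H" using \<open>H \<noteq> {}\<close> by blast
  then have "b < x" "x \<le> t" using H(1,3) b tA[of x] by auto
  then have "b < t" by simp
  then have "t \<in> H" using bmax[of t] tin by force
  obtain i where i: "1 \<le> i" "i \<le> n" "b = d * (2 * int i - 1)" using b by (auto elim: odd_multiplesE)
  have "i \<noteq> n" using i \<open>b < t\<close> by (auto simp: t_def)
  then have "b + 2 * d \<in> ?A" using i unfolding odd_multiples_def
    by (intro image_eqI[of _ _ "Suc i"]) (auto simp: algebra_simps)
  then have g: "b + 2 * d \<in> H" using bmax[of "b + 2 * d"] d by force
  \<comment> \<open>Otherwise \<open>H\<close> would be \<open>{t}\<close>, against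
    \<open>2 \<le> h\<close>.\<close>
  have "b + 2 * d \<noteq> t"
  proof
    assume eq: "b + 2 * d = t"
    have "H \<subseteq> {t}"
    proof
      fix y assume y: "y \<in> H"
      then obtain j where j: "y = d * (2 * int j - 1)" using H by (auto elim: odd_multiplesE)
      have "b < y" using H(3) y b by auto
      then have "d * (2 * int i - 1) < d * (2 * int j - 1)" using i j by simp
      then have "2 * int i + 1 \<le> 2 * int j - 1" using d by simp
      then have "d * (2 * int i + 1) \<le> y" unfolding j using d by (intro mult_left_mono) auto
      then have "t \<le> y" using eq i by (simp add: algebra_simps)
      then show "y \<in> {t}" using tA[of y] y H(1) by auto
    qed
    then have "card H \<le> card {t}" by (intro card_mono) auto
    then show False using H h by simp
  qed
  have mH: "m \<notin> ?A" using mA by blast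
  define v where "v = \<Sum>H + m - t - 2 * d"
  define W where "W = (\<lambda>j. \<Sum>H + m - j) ` H"
  let ?S = "restricted_signed_sumset h ?A"
  have vS: "v \<in> restricted_signed_sumset h (insert m ?A)"
  proof -
    let ?H = "H - {t} - {b + 2 * d}"
    have "\<Sum>?H = \<Sum>H - t - (b + 2 * d)" using finH \<open>t \<in> H\<close> g \<open>b + 2 * d \<noteq> t\<close> by (simp add: sum_diff1)
    then have "v = \<Sum>(insert m (insert b ?H))" using finH mH b H by (subst sum.insert) (auto simp: v_def)
    moreover have "card (insert m (insert b ?H)) = h"
    proof -
      have "card ?H = h - 2" using finH \<open>t \<in> H\<close> g \<open>b + 2 * d \<noteq> t\<close> H by simp
      moreover have "m \<notin> insert b ?H" "b \<notin> ?H" using mH b H by auto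
      ultimately show ?thesis using finH h by simp
    qed
    ultimately show ?thesis
      using restricted_signed_sumsetI[of "insert m ?A" "insert m (insert b ?H)" h] fin H b by auto
  qed
  have sH: "t + d \<le> \<Sum>H"
  proof -
    have "d \<le> \<Sum>(H - {t})"
      using member_le_sum[of "b + 2 * d" "H - {t}" "\<lambda>x. x"] g \<open>b + 2 * d \<noteq> t\<close> finH H(1) pos[OF b(1)] d
        less_imp_le[OF pos] by force
    then show ?thesis using finH \<open>t \<in> H\<close> by (simp add: sum_diff1)
  qed
  have tpos: "0 < t" using pos[OF tin] .
  \<comment> \<open>The bound \<open>v \<le> \<Sum>H\<close> would give
    \<open>m < t + 2 * d\<close>, while the congruence of all old sums modulo \<open>2 * d\<close>
    would make \<open>m - t\<close>, which is positive, divisible by \<open>2 * d\<close>.\<close>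
  have "v \<notin> ?S"
  proof
    assume v: "v \<in> ?S"
    have "v \<le> \<Sum>H" using restricted_signed_sumset_bound[OF fin pos H(1,3), of v] v H(2) by simp
    then have "m < t + 2 * d" using m(2) by (auto simp: v_def t_def algebra_simps)
    have "\<Sum>H \<in> ?S" using restricted_signed_sumsetI[OF fin H(1,2)] .
    then have "2 * d dvd (v - d * int h) - (\<Sum>H - d * int h)"
      using v by (intro dvd_diff[OF dvd_restricted_signed_sumset_odd_multiples dvd_restricted_signed_sumset_odd_multiples])
    then have "2 * d dvd ((v - d * int h) - (\<Sum>H - d * int h)) + 2 * d" by (rule dvd_add) simp
    then have "2 * d dvd m - t" by (simp add: v_def)
    then have "2 * d \<le> m - t" using m(1) by (intro zdvd_imp_le) (auto simp: t_def)
    then show False using \<open>m < t + 2 * d\<close> by simp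
  qed
  moreover have "v \<notin> W"
  proof
    assume "v \<in> W"
    then obtain j where j: "j \<in> H" "v = \<Sum>H + m - j" by (auto simp: W_def)
    then have "j = t + 2 * d" by (simp add: v_def)
    then show False using j tA[of j] H(1) d by auto
  qed
  moreover have "v \<notin> uminus ` W"
  proof
    assume "v \<in> uminus ` W"
    then obtain j where j: "j \<in> H" "v = - (\<Sum>H + m - j)" by (auto simp: W_def)
    then show False using mA[of j] H(1) m(1) sH tpos d by (auto simp: v_def t_def)
  qed
  ultimately have "v \<notin> ?S \<union> W \<union> uminus ` W" by blast
  moreover have sub: "?S \<union> W \<union> uminus ` W \<subseteq> restricted_signed_sumset h (insert m ?A)"
    and "card (?S \<union> W \<union> uminus ` W) = card ?S + 2 * h"
    using restricted_signed_sumset_new[OF fin pos mA H(1,3)] H(2) by (simp_all add: W_def)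
  moreover have "card (?S \<union> W \<union> uminus ` W) < card (restricted_signed_sumset h (insert m ?A))"
    using finite_restricted_signed_sumset[of "insert m ?A" h] fin sub vS \<open>v \<notin> ?S \<union> W \<union> uminus ` W\<close>
    by (intro psubset_card_mono) auto
  ultimately show ?thesis by simp
qed

text \<open>The square is added on the left to avoid truncated subtraction. At
  \<open>k = Suc h\<close> this is the bound for sums omitting one element; each further maximum
  adds at least \<open>2 * h\<close> sums, and equality determines it.\<close>

lemma card_restricted_signed_sumset_ge:
  assumes "3 \<le> h" "Suc h \<le> k" "finite A" "\<And>a. a \<in> A \<Longrightarrow> 0 < a" "card A = k"
  shows "2 * h * k + 1 \<le> card (restricted_signed_sumset h A) + h\<^sup>2 \<and>
    (card (restricted_signed_sumset h A) + h\<^sup>2 = 2 * h * k + 1 \<longrightarrow> (\<exists>d>0. A = odd_multiples d k))"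
  using assms(2-)
proof (induction k arbitrary: A rule: dec_induct)
  case base
  have "card (restricted_signed_sumset h A) = card (omit_one_sums A)"
    using base by (intro card_restricted_signed_sumset_omit_one) auto
  moreover have "(Suc h)\<^sup>2 + h\<^sup>2 = 2 * h * Suc h + 1" by (simp add: power2_eq_square)
  ultimately show ?case using card_omit_one_sums_ge[of "Suc h" A] base assms(1) by auto
next
  case (step n)
  define m where "m = Max A"
  have "A \<noteq> {}" using step.prems by auto
  then have m: "m \<in> A" using step.prems by (simp add: m_def)
  have c: "card (A - {m}) = n" using m step by simp
  have lt: "a < m" if "a \<in> A - {m}" for a using that step.prems(1) by (auto simp: m_def less_le)
  have A: "insert m (A - {m}) = A" using m by blast
  have fin: "finite (A - {m})" using step.prems by simp
  have IH: "2 * h * n + 1 \<le> card (restricted_signed_sumset h (A - {m})) + h\<^sup>2"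
    "card (restricted_signed_sumset h (A - {m})) + h\<^sup>2 = 2 * h * n + 1 \<Longrightarrow> \<exists>d>0. A - {m} = odd_multiples d n"
    using step.IH[of "A - {m}"] c step.prems by auto
  obtain H where H: "H \<subseteq> A - {m}" "card H = h" "\<forall>x\<in>H. \<forall>y\<in>A - {m} - H. y < x"
    using exists_top_subset[OF fin, of h] step.hyps c by auto
  define W where "W = (\<lambda>j. \<Sum>H + m - j) ` H"
  let ?U = "restricted_signed_sumset h (A - {m}) \<union> W \<union> uminus ` W"
  have "?U \<subseteq> restricted_signed_sumset h A" "card ?U = card (restricted_signed_sumset h (A - {m})) + 2 * h"
    using restricted_signed_sumset_new[OF fin _ lt H(1,3)] step.prems(2) H(2) A by (simp_all add: W_def)
  then have st: "card (restricted_signed_sumset h (A - {m})) + 2 * h \<le> card (restricted_signed_sumset h A)"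
    using card_mono[OF finite_restricted_signed_sumset[OF step.prems(1)], of ?U h] by simp
  have "\<exists>d>0. A = odd_multiples d (Suc n)" if eq: "card (restricted_signed_sumset h A) + h\<^sup>2 = 2 * h * Suc n + 1"
  proof -
    have eq': "card (restricted_signed_sumset h (A - {m})) + h\<^sup>2 = 2 * h * n + 1" using eq st IH(1) by simp
    then obtain d where d: "0 < d" "A - {m} = odd_multiples d n" using IH(2) by blast
    have "d * (2 * int n - 1) \<in> A - {m}" unfolding d(2) odd_multiples_def using step.hyps by auto
    then have "d * (2 * int n - 1) < m" by (rule lt)
    then have "m = d * (2 * int n + 1)"
      using card_restricted_signed_sumset_extend[OF d(1), of h n m] A d(2) eq eq' step.hyps assms(1) by fastforce
    then show ?thesis using A d by (metis odd_multiples_Suc)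
  qed
  then show ?case using st IH(1) by auto
qed

theorem theorem4:
  fixes h k :: nat and A :: "int set"
  assumes "3 \<le> h" and "h \<le> k - 1"
    and "finite A" and "card A = k"
    and "A \<inter> uminus ` A = {}"
    and "int (card (restricted_signed_sumset h A)) = 2 * int h * int k - (int h)\<^sup>2 + 1"
  shows "A_abs A = dilate (Min (A_abs A)) {2 * int i - 1 | i. 1 \<le> i \<and> i \<le> k}"
proof -
  have B: "A_abs A = abs ` A" by (auto simp: A_abs_def)
  note inj = inj_on_abs[OF assms(5)]
  have pos: "0 < a" if "a \<in> A_abs A" for a using that assms(5) by (force simp: B)
  have finB: "finite (A_abs A)" and card: "card (A_abs A) = k"
    using assms(3,4) card_image[OF inj] by (simp_all add: B)
  \<comment> \<open>The prescribed count for \<open>A\<close> bounds that of \<open>A_abs A\<close>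
    from above by the general lower bound, so equality holds there.\<close>
  have "card (restricted_signed_sumset h (A_abs A)) \<le> card (restricted_signed_sumset h A)"
    using restricted_signed_sumset_A_abs[OF assms(3,5)] finite_restricted_signed_sumset[OF assms(3)]
    by (intro card_mono)
  moreover have "int (card (restricted_signed_sumset h A) + h\<^sup>2) = int (2 * h * k + 1)" using assms(6) by simp
  then have "card (restricted_signed_sumset h A) + h\<^sup>2 = 2 * h * k + 1" by (simp only: of_nat_eq_iff)
  moreover have "2 * h * k + 1 \<le> card (restricted_signed_sumset h (A_abs A)) + h\<^sup>2 \<and>
    (card (restricted_signed_sumset h (A_abs A)) + h\<^sup>2 = 2 * h * k + 1 \<longrightarrow> (\<exists>d>0. A_abs A = odd_multiples d k))"
    using assms(1,2) finB pos card by (intro card_restricted_signed_sumset_ge) auto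
  ultimately obtain d where d: "0 < d" "A_abs A = odd_multiples d k" by auto
  have "d \<in> odd_multiples d k" using assms(1,2) unfolding odd_multiples_def by (intro image_eqI[of _ _ 1]) auto
  then have "Min (A_abs A) = d"
    using odd_multiples_bounds(1)[OF d(1)] unfolding d(2) by (intro Min_eqI finite_odd_multiples)
  then show ?thesis unfolding d(2) by (auto simp: dilate_def odd_multiples_def)
qed

end
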